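(* Let $E$ be a complex Banach space and let $\mathcal{I}$ be an ideal in $\mathcal{H}_b(E,E)$. 1) The set $\mathcal{I}_{\mathcal{L}}:=\{df(0):f\in\mathcal{I}\}$ is an ideal in $\mathcal{L}(E)$, and $\mathcal{I}_{\mathcal{L}}=\{df(x):f\in\mathcal{I}\text{ and }x\in E\}$. 2) If $\mathcal{I}$ is closed and contains some non-constant mapping, then the operator ideal $\mathcal{F}(E)$ of finite rank operators is contained in $\mathcal{I}$. If, moreover, $E$ has the approximation property, then $\mathcal{H}_k(E,E)\subset\mathcal{I}$.
   Context: $\mathcal{H}_b(E,E)$ is the space of holomorphic (complex Fréchet differentiable) mappings $f:E\to E$ that are bounded on every bounded subset of $E$, with the topology of uniform convergence on bounded sets ("closed" refers to this topology). $\mathcal{H}_k(E,E)$ is its subspace of mappings that map bounded sets into relatively compact sets. $\mathcal{L}(E)$ is the algebra of bounded linear operators on $E$ (a subset of $\mathcal{H}_b(E,E)$), and $\mathcal{F}(E)\subset\mathcal{L}(E)$ the finite rank ones. $df(x)\in\mathcal{L}(E)$ is the Fréchet derivative of $f$ at $x$. An ideal in $\mathcal{H}_b(E,E)$ is a linear subspace $\mathcal{I}$ such that $f\circ g\circ h\in\mathcal{I}$ whenever $g\in\mathcal{I}$ and $f,h\in\mathcal{H}_b(E,E)$. Ideals in $\mathcal{L}(E)$ are two-sided algebra ideals. $E$ has the approximation property if for every compact $K\subset E$ and $\varepsilon>0$ there is $T\in\mathcal{F}(E)$ with $\|Tu-u\|<\varepsilon$ for all $u\in K$. *)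

theory Defs
  imports "HOL-Analysis.Analysis"
begin

text \<open>
  Complex Banach spaces. The library's class \<open>banach\<close> consists of real Banach spaces; a complex Banach
  space is one carrying a complex scalar multiplication that extends the real one and for which
  the norm is absolutely homogeneous over the complex numbers.
\<close>

class complex_banach = banach +
  fixes scaleC :: "complex \<Rightarrow> 'a \<Rightarrow> 'a"  (infixr "*\<^sub>C" 75)
  assumes scaleC_add_right: "c *\<^sub>C (x + y) = c *\<^sub>C x + c *\<^sub>C y"
    and scaleC_add_left: "(c + d) *\<^sub>C x = c *\<^sub>C x + d *\<^sub>C x"
    and scaleC_scaleC: "c *\<^sub>C d *\<^sub>C x = (c * d) *\<^sub>C x"
    and scaleC_one: "1 *\<^sub>C x = x"
    and scaleC_of_real: "complex_of_real r *\<^sub>C x = r *\<^sub>R x"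
    and norm_scaleC: "norm (c *\<^sub>C x) = cmod c * norm x"

lemma vector_space_scaleC: "vector_space (scaleC :: complex \<Rightarrow> 'a \<Rightarrow> 'a::complex_banach)"
  by unfold_locales (simp_all add: scaleC_add_right scaleC_add_left scaleC_scaleC scaleC_one)

instantiation complex :: complex_banach
begin

definition scaleC_complex :: "complex \<Rightarrow> complex \<Rightarrow> complex"
  where "scaleC_complex c z = c * z"

instance
  by standard (simp_all add: scaleC_complex_def distrib_left distrib_right norm_mult scaleR_conv_of_real)

end

text \<open>
  Operators are represented as plain functions, so that \<open>bounded_operators\<close> is literally a
  subset of \<open>holomorphic_bounded\<close>.
\<close>

definition bounded_operators :: "('a::complex_banach \<Rightarrow> 'a) set"
  where "bounded_operators = {T. bounded_linear T \<and> (\<forall>c x. T (c *\<^sub>C x) = c *\<^sub>C T x)}"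

definition finite_rank_operators :: "('a::complex_banach \<Rightarrow> 'a) set"
  where "finite_rank_operators =
    {T \<in> bounded_operators. \<exists>B. finite B \<and> range T \<subseteq> module.span scaleC B}"

text \<open>
  Complex Frechet differentiability at every point. Since \<open>has_derivative\<close> only asks for a
  real-linear derivative, its complex linearity is required explicitly. Derivatives are unique,
  so for such \<open>f\<close> the library's \<open>frechet_derivative f (at x)\<close> is this complex-linear operator.
\<close>

definition holomorphic :: "('a::complex_banach \<Rightarrow> 'a) \<Rightarrow> bool"
  where "holomorphic f \<longleftrightarrow> (\<forall>x. \<exists>D \<in> bounded_operators. (f has_derivative D) (at x))"

definition holomorphic_bounded :: "('a::complex_banach \<Rightarrow> 'a) set"
  where "holomorphic_bounded = {f. holomorphic f \<and> (\<forall>B. bounded B \<longrightarrow> bounded (f ` B))}"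

definition holomorphic_compact :: "('a::complex_banach \<Rightarrow> 'a) set"
  where "holomorphic_compact =
    {f \<in> holomorphic_bounded. \<forall>B. bounded B \<longrightarrow> compact (closure (f ` B))}"

text \<open>The topology of uniform convergence on bounded sets, on the carrier \<open>holomorphic_bounded\<close>.\<close>

definition Hb_topology :: "('a::complex_banach \<Rightarrow> 'a) topology"
  where "Hb_topology = topology (\<lambda>U. U \<subseteq> holomorphic_bounded \<and>
    (\<forall>f\<in>U. \<exists>B e. bounded B \<and> 0 < e \<and>
      {g \<in> holomorphic_bounded. \<forall>x\<in>B. norm (g x - f x) < e} \<subseteq> U))"

lemma openin_Hb_topology:
  "openin Hb_topology U \<longleftrightarrow> U \<subseteq> holomorphic_bounded \<and>
    (\<forall>f\<in>U. \<exists>B e. bounded B \<and> 0 < e \<and>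
      {g \<in> holomorphic_bounded. \<forall>x\<in>B. norm (g x - f x) < e} \<subseteq> U)"
proof -
  define N :: "'a set \<Rightarrow> real \<Rightarrow> ('a \<Rightarrow> 'a) \<Rightarrow> ('a \<Rightarrow> 'a) set"
    where "N B e f = {g \<in> holomorphic_bounded. \<forall>x\<in>B. norm (g x - f x) < e}" for B e f
  let ?L = "\<lambda>U. U \<subseteq> holomorphic_bounded \<and>
    (\<forall>f\<in>U. \<exists>B e. bounded B \<and> 0 < e \<and> N B e f \<subseteq> U)"
  have "istopology ?L"
    unfolding istopology_def
  proof (intro conjI allI impI)
    fix S T :: "('a \<Rightarrow> 'a) set"
    assume S: "?L S" and T: "?L T"
    show "S \<inter> T \<subseteq> holomorphic_bounded" using conjunct1[OF S] by (rule le_infI1)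
    show "\<forall>f\<in>S \<inter> T. \<exists>B e. bounded B \<and> 0 < e \<and> N B e f \<subseteq> S \<inter> T"
    proof
      fix f assume f: "f \<in> S \<inter> T"
      obtain B e where 1: "bounded B" "0 < e" "N B e f \<subseteq> S"
        using bspec[OF conjunct2[OF S], of f] f by auto
      obtain C d where 2: "bounded C" "0 < d" "N C d f \<subseteq> T"
        using bspec[OF conjunct2[OF T], of f] f by auto
      have "N (B \<union> C) (min e d) f \<subseteq> N B e f \<inter> N C d f" by (auto simp: N_def)
      also have "\<dots> \<subseteq> S \<inter> T" using 1(3) 2(3) by (rule Int_mono)
      finally show "\<exists>B e. bounded B \<and> 0 < e \<and> N B e f \<subseteq> S \<inter> T"
        using 1 2 by (intro exI[of _ "B \<union> C"] exI[of _ "min e d"]) simp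
    qed
  next
    fix \<K> :: "('a \<Rightarrow> 'a) set set"
    assume K: "\<forall>K\<in>\<K>. ?L K"
    show "\<Union>\<K> \<subseteq> holomorphic_bounded"
      by (rule Union_least) (rule conjunct1[OF bspec[OF K]])
    show "\<forall>f\<in>\<Union>\<K>. \<exists>B e. bounded B \<and> 0 < e \<and> N B e f \<subseteq> \<Union>\<K>"
    proof
      fix f assume "f \<in> \<Union>\<K>"
      then obtain K' where K': "K' \<in> \<K>" "f \<in> K'" by (rule UnionE)
      obtain B e where 1: "bounded B" "0 < e" "N B e f \<subseteq> K'"
        using bspec[OF conjunct2[OF bspec[OF K K'(1)]] K'(2)] by auto
      have "N B e f \<subseteq> \<Union>\<K>" using 1(3) Union_upper[OF K'(1)] by (rule subset_trans)
      with 1 show "\<exists>B e. bounded B \<and> 0 < e \<and> N B e f \<subseteq> \<Union>\<K>"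
        by (intro exI[of _ B] exI[of _ e]) simp
    qed
  qed
  from topology_inverse'[OF this] show ?thesis
    by (simp only: Hb_topology_def N_def)
qed

lemma topspace_Hb_topology: "topspace Hb_topology = (holomorphic_bounded :: ('a::complex_banach \<Rightarrow> 'a) set)"
proof
  show "topspace Hb_topology \<subseteq> (holomorphic_bounded :: ('a \<Rightarrow> 'a) set)"
    by (rule conjunct1[OF iffD1[OF openin_Hb_topology openin_topspace]])
  have "\<exists>B e. bounded B \<and> 0 < e \<and>
      {g \<in> holomorphic_bounded. \<forall>x\<in>B. norm (g x - f x) < e} \<subseteq> holomorphic_bounded"
    for f :: "'a \<Rightarrow> 'a"
    by (rule exI[of _ "{}"], rule exI[of _ 1]) simp
  then have "openin Hb_topology (holomorphic_bounded :: ('a \<Rightarrow> 'a) set)"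
    by (simp only: openin_Hb_topology) simp
  then show "(holomorphic_bounded :: ('a \<Rightarrow> 'a) set) \<subseteq> topspace Hb_topology"
    by (rule openin_subset)
qed

definition linear_subspace_of_maps :: "('a::complex_banach \<Rightarrow> 'a) set \<Rightarrow> bool"
  where "linear_subspace_of_maps S \<longleftrightarrow>
    (\<lambda>x. 0) \<in> S \<and>
    (\<forall>f\<in>S. \<forall>g\<in>S. (\<lambda>x. f x + g x) \<in> S) \<and>
    (\<forall>c. \<forall>f\<in>S. (\<lambda>x. c *\<^sub>C f x) \<in> S)"

definition holomorphic_ideal :: "('a::complex_banach \<Rightarrow> 'a) set \<Rightarrow> bool"
  where "holomorphic_ideal I \<longleftrightarrow>
    I \<subseteq> holomorphic_bounded \<and> linear_subspace_of_maps I \<and>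
    (\<forall>g\<in>I. \<forall>f\<in>holomorphic_bounded. \<forall>h\<in>holomorphic_bounded. f \<circ> g \<circ> h \<in> I)"

definition operator_ideal :: "('a::complex_banach \<Rightarrow> 'a) set \<Rightarrow> bool"
  where "operator_ideal J \<longleftrightarrow>
    J \<subseteq> bounded_operators \<and> linear_subspace_of_maps J \<and>
    (\<forall>T\<in>J. \<forall>S\<in>bounded_operators. S \<circ> T \<in> J \<and> T \<circ> S \<in> J)"

definition approximation_property :: "'a::complex_banach itself \<Rightarrow> bool"
  where "approximation_property _ \<longleftrightarrow>
    (\<forall>K :: 'a set. compact K \<longrightarrow>
      (\<forall>\<epsilon>>0. \<exists>T\<in>finite_rank_operators. \<forall>u\<in>K. norm (T u - u) < \<epsilon>))"

end

theory Submission
  imports Defs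
begin

text \<open>
  Composing with translations moves every point of differentiation to the origin, and the chain
  rule at the origin gives the first part. For the second part, a non-constant member of the ideal
  yields a member \<open>g\<close> with \<open>g 0 = 0\<close> and \<open>T = dg(0) \<noteq> 0\<close>; the maps \<open>x \<mapsto> g(r x)/r\<close> lie in the
  ideal and converge to \<open>T\<close> uniformly on bounded sets as \<open>r \<rightarrow> 0\<close>, so \<open>T\<close> is in the ideal. By Hahn--Banach,
  every rank one operator factors through \<open>T\<close>. Correcting an operator by rank one operators one
  vector at a time gives, for each finite set \<open>B\<close>, an operator \<open>P\<close> in the ideal that fixes \<open>B\<close>;
  if \<open>S\<close> has range in the span of \<open>B\<close>, then \<open>S = P \<circ> S\<close>. Finally, if \<open>f\<close> maps bounded sets to
  relatively compact ones, the approximation property provides finite rank \<open>S\<close> with \<open>S \<circ> f\<close>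
  close to \<open>f\<close> on a given bounded set.
\<close>

subsection \<open>The Hahn--Banach theorem\<close>

text \<open>Homogeneity is stated as an inequality, so that for an infimum only one direction has to
  be checked. Rescaling by \<open>1 / s\<close> recovers equality for positive \<open>s\<close>, and
  \<open>s = 0\<close> gives \<open>q 0 \<le> 0\<close>.\<close>

definition sublinear :: "('a::real_vector \<Rightarrow> real) \<Rightarrow> bool"
  where "sublinear q \<longleftrightarrow>
    (\<forall>x y. q (x + y) \<le> q x + q y) \<and> (\<forall>s\<ge>0. \<forall>x. q (s *\<^sub>R x) \<le> s * q x)"

lemma sublinear_add: "sublinear q \<Longrightarrow> q (x + y) \<le> q x + q y"
  by (simp add: sublinear_def)

lemma sublinear_scaleR_le: "sublinear q \<Longrightarrow> 0 \<le> s \<Longrightarrow> q (s *\<^sub>R x) \<le> s * q x"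
  by (simp add: sublinear_def)

lemma sublinear_zero: "sublinear q \<Longrightarrow> q 0 = 0"
  using sublinear_add[of q 0 0] sublinear_scaleR_le[of q 0 0] by simp

lemma sublinear_minus: "sublinear q \<Longrightarrow> - q (- x) \<le> q x"
  using sublinear_add[of q x "- x"] by (simp add: sublinear_zero)

lemma sublinear_scaleR:
  assumes "sublinear q" "0 \<le> s"
  shows "q (s *\<^sub>R x) = s * q x"
proof (cases "s = 0")
  case True
  then show ?thesis using assms by (simp add: sublinear_zero)
next
  case False
  then have "q x \<le> (1 / s) * q (s *\<^sub>R x)"
    using sublinear_scaleR_le[of q "1 / s" "s *\<^sub>R x"] assms by simp
  then have "s * q x \<le> q (s *\<^sub>R x)" using False assms(2) by (simp add: field_simps)
  then show ?thesis using sublinear_scaleR_le[OF assms, of x] by simp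
qed

lemma sublinear_norm: "sublinear norm"
  by (simp add: sublinear_def norm_triangle_ineq)

text \<open>Lowering \<open>q\<close> along the ray spanned by \<open>y\<close> keeps it sublinear
  and pushes the value at \<open>- y\<close> down to \<open>- q y\<close>. A minimal sublinear
  function cannot be lowered, so it must be odd.\<close>

lemma sublinear_reduce:
  fixes q :: "'a::real_vector \<Rightarrow> real"
  assumes q: "sublinear q"
  obtains r where "sublinear r" "r \<le> q" "r (- y) \<le> - q y"
proof
  define r where "r = (\<lambda>x. INF t\<in>{0..}. q (x + t *\<^sub>R y) - t * q y)"
  \<comment> \<open>This bound does not depend on \<open>t\<close>, so the infimum defining
    \<open>r\<close> is a genuine real number.\<close>
  have lower: "- q (- x) \<le> q (x + t *\<^sub>R y) - t * q y" if "0 \<le> t" for x t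
    using sublinear_add[OF q, of "x + t *\<^sub>R y" "- x"] sublinear_scaleR[OF q that, of y] by simp
  have upper: "r x \<le> q (x + t *\<^sub>R y) - t * q y" if "0 \<le> t" for x t
    unfolding r_def using that lower by (intro cINF_lower bdd_belowI2[of _ "- q (- x)"]) auto
  have greatest: "m \<le> r x" if "\<And>t. 0 \<le> t \<Longrightarrow> m \<le> q (x + t *\<^sub>R y) - t * q y" for m x
    unfolding r_def using that by (intro cINF_greatest) auto
  have add: "r (x + z) \<le> r x + r z" for x z
  proof -
    \<comment> \<open>The infima for \<open>x\<close> and \<open>z\<close> are taken one after the
      other: with \<open>u\<close> fixed, the parameter \<open>t + u\<close> is admissible for
      \<open>x + z\<close>.\<close>
    have "r (x + z) - (q (z + u *\<^sub>R y) - u * q y) \<le> r x" if u: "0 \<le> u" for u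
    proof (rule greatest)
      fix t :: real assume t: "0 \<le> t"
      have "r (x + z) \<le> q ((x + z) + (t + u) *\<^sub>R y) - (t + u) * q y"
        using t u by (intro upper) simp
      also have "(x + z) + (t + u) *\<^sub>R y = (x + t *\<^sub>R y) + (z + u *\<^sub>R y)"
        by (simp add: algebra_simps)
      also have "q \<dots> \<le> q (x + t *\<^sub>R y) + q (z + u *\<^sub>R y)" by (rule sublinear_add[OF q])
      finally show "r (x + z) - (q (z + u *\<^sub>R y) - u * q y) \<le> q (x + t *\<^sub>R y) - t * q y"
        by (simp add: algebra_simps)
    qed
    then have "r (x + z) - r x \<le> r z"
      by (intro greatest) (simp add: algebra_simps)
    then show ?thesis by simp
  qed
  have scale: "r (s *\<^sub>R x) \<le> s * r x" if s: "0 \<le> s" for s x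
  proof (cases "s = 0")
    case True
    then show ?thesis using upper[of 0 0] by (simp add: sublinear_zero[OF q])
  next
    case False
    with s have s: "0 < s" by simp
    \<comment> \<open>The parameter \<open>t\<close> for \<open>x\<close> corresponds to
      \<open>s * t\<close> for the scaled vector.\<close>
    have "r (s *\<^sub>R x) / s \<le> r x"
    proof (rule greatest)
      fix t :: real assume t: "0 \<le> t"
      have "r (s *\<^sub>R x) \<le> q (s *\<^sub>R x + (s * t) *\<^sub>R y) - (s * t) * q y"
        using s t by (intro upper) simp
      also have "s *\<^sub>R x + (s * t) *\<^sub>R y = s *\<^sub>R (x + t *\<^sub>R y)" by (simp add: algebra_simps)
      also have "q \<dots> = s * q (x + t *\<^sub>R y)" using s by (intro sublinear_scaleR[OF q]) simp
      finally show "r (s *\<^sub>R x) / s \<le> q (x + t *\<^sub>R y) - t * q y"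
        using s by (simp add: field_simps)
    qed
    then show ?thesis using s by (simp add: field_simps)
  qed
  show "sublinear r" using add scale by (simp add: sublinear_def)
  show "r \<le> q" using upper[of 0] by (simp add: le_fun_def)
  show "r (- y) \<le> - q y" using upper[of 1 "- y"] by (simp add: sublinear_zero[OF q])
qed

text \<open>Zorn's lemma applies because the pointwise infimum of a nonempty chain of sublinear
  functions below \<open>p\<close> is again sublinear; it is finite since every member is at least
  \<open>- p (- x)\<close> at \<open>x\<close>.\<close>

lemma minimal_sublinear:
  fixes p :: "'a::real_vector \<Rightarrow> real"
  assumes p: "sublinear p"
  obtains q where "sublinear q" "q \<le> p" "\<And>r. sublinear r \<Longrightarrow> r \<le> q \<Longrightarrow> r = q"
proof -
  let ?A = "{q. sublinear q \<and> q \<le> p}"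
  \<comment> \<open>The order is reversed, so that the maximal element given by Zorn's lemma is a
    minimal function.\<close>
  let ?R = "relation_of (\<ge>) ?A"
  have "partial_order_on ?A ?R" by (rule partial_order_on_relation_ofI) auto
  moreover have "\<exists>u\<in>?A. \<forall>q\<in>C. q \<ge> u" if C: "C \<in> Chains ?R" for C
  proof (cases "C = {}")
    case True
    then show ?thesis using p by auto
  next
    case ne: False
    have CA: "q \<in> ?A" if "q \<in> C" for q
      using C that unfolding Chains_def relation_of_def by blast
    have total: "q \<le> r \<or> r \<le> q" if "q \<in> C" "r \<in> C" for q r
      using C that unfolding Chains_def relation_of_def by blast
    define u where "u = (\<lambda>x. INF q\<in>C. q x)"
    have "- p (- x) \<le> q x" if "q \<in> C" for q x
    proof -
      have "q (- x) \<le> p (- x)" using CA[OF that] by (simp add: le_fun_def)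
      moreover have "- q (- x) \<le> q x" using CA[OF that] by (simp add: sublinear_minus)
      ultimately show ?thesis by simp
    qed
    then have upper: "u x \<le> q x" if "q \<in> C" for q x
      unfolding u_def using that by (intro cINF_lower bdd_belowI2[of _ "- p (- x)"]) auto
    have greatest: "m \<le> u x" if "\<And>q. q \<in> C \<Longrightarrow> m \<le> q x" for m x
      unfolding u_def using that ne by (intro cINF_greatest) auto
    have "u (x + z) \<le> u x + u z" for x z
    proof -
      \<comment> \<open>Of two members of a chain one lies below the other, so one member
        \<open>s\<close> serves both summands.\<close>
      have pair: "u (x + z) \<le> q x + r z" if qr: "q \<in> C" "r \<in> C" for q r
      proof -
        have "\<exists>s\<in>C. s \<le> q \<and> s \<le> r" using total[OF qr] qr by blast
        then obtain s where s: "s \<in> C" "s \<le> q" "s \<le> r" by blast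
        have "u (x + z) \<le> s (x + z)" by (rule upper[OF s(1)])
        also have "\<dots> \<le> s x + s z" using CA[OF s(1)] by (simp add: sublinear_add)
        also have "\<dots> \<le> q x + r z" using s by (intro add_mono) (simp_all add: le_fun_def)
        finally show ?thesis .
      qed
      have "u (x + z) - r z \<le> u x" if "r \<in> C" for r
        using pair[OF _ that] by (intro greatest) (simp add: algebra_simps)
      then have "u (x + z) - u x \<le> u z" by (intro greatest) (simp add: algebra_simps)
      then show ?thesis by simp
    qed
    moreover have "u (s *\<^sub>R x) \<le> s * u x" if s: "0 \<le> s" for s x
    proof (cases "s = 0")
      case True
      obtain q where "q \<in> C" using ne by blast
      then show ?thesis using True upper[of q 0] CA[of q] by (simp add: sublinear_zero)
    next
      case False
      with s have s: "0 < s" by simp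
      have "u (s *\<^sub>R x) / s \<le> u x"
      proof (rule greatest)
        fix q assume q: "q \<in> C"
        have "u (s *\<^sub>R x) \<le> s * q x"
          using upper[OF q, of "s *\<^sub>R x"] sublinear_scaleR[of q s x] CA[OF q] s by simp
        then show "u (s *\<^sub>R x) / s \<le> q x" using s by (simp add: field_simps)
      qed
      then show ?thesis using s by (simp add: field_simps)
    qed
    ultimately have "sublinear u" by (simp add: sublinear_def)
    moreover have "u \<le> p"
    proof -
      obtain q where q: "q \<in> C" using ne by blast
      have "u \<le> q" using upper[OF q] by (simp add: le_fun_def)
      also have "q \<le> p" using CA[OF q] by simp
      finally show ?thesis .
    qed
    ultimately show ?thesis using upper by (intro bexI[of _ u]) (auto simp: le_fun_def)
  qed
  ultimately obtain q where q: "q \<in> ?A" "\<And>r. r \<in> ?A \<Longrightarrow> r \<le> q \<Longrightarrow> r = q"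
    using predicate_Zorn[of ?A "(\<ge>)"] by blast
  show ?thesis
  proof (rule that)
    show "sublinear q" "q \<le> p" using q(1) by auto
    show "r = q" if "sublinear r" "r \<le> q" for r
      using q that by (auto intro: order_trans)
  qed
qed

text \<open>A minimal sublinear function is odd, and an odd sublinear function is linear:
  subadditivity at \<open>x, y\<close> and at \<open>- x, - y\<close> gives the two inequalities of
  additivity.\<close>

lemma real_norming_functional:
  fixes c :: "'a::real_normed_vector"
  obtains \<phi> :: "'a \<Rightarrow> real"
  where "bounded_linear \<phi>" "\<And>x. \<bar>\<phi> x\<bar> \<le> norm x" "\<phi> c = norm c"
proof -
  \<comment> \<open>Reducing the norm in the direction \<open>c\<close> before minimising forces
    \<open>\<phi> c \<ge> norm c\<close> once oddness is known.\<close>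
  obtain p where p: "sublinear p" "p \<le> norm" "p (- c) \<le> - norm c"
    using sublinear_reduce[OF sublinear_norm] .
  obtain \<phi> where \<phi>: "sublinear \<phi>" "\<phi> \<le> p" and min: "\<And>r. sublinear r \<Longrightarrow> r \<le> \<phi> \<Longrightarrow> r = \<phi>"
    by (rule minimal_sublinear[OF p(1)]) blast
  have odd: "\<phi> (- x) = - \<phi> x" for x
  proof -
    obtain r where r: "sublinear r" "r \<le> \<phi>" "r (- x) \<le> - \<phi> x"
      using sublinear_reduce[OF \<phi>(1)] .
    then have "\<phi> (- x) \<le> - \<phi> x" using min by blast
    then show ?thesis using sublinear_minus[OF \<phi>(1), of x] by simp
  qed
  have le: "\<phi> x \<le> norm x" for x
    using \<phi>(2) p(2) by (meson le_fun_def order_trans)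
  have abs: "\<bar>\<phi> x\<bar> \<le> norm x" for x using le[of x] le[of "- x"] odd[of x] by simp
  have "bounded_linear \<phi>"
  proof (rule bounded_linear_intro[where K = 1])
    show "\<phi> (x + y) = \<phi> x + \<phi> y" for x y
      using sublinear_add[OF \<phi>(1), of x y] sublinear_add[OF \<phi>(1), of "- x" "- y"]
        odd[of x] odd[of y] odd[of "x + y"] by simp
    show "\<phi> (s *\<^sub>R x) = s *\<^sub>R \<phi> x" for s x
    proof (cases "0 \<le> s")
      case True
      then show ?thesis using sublinear_scaleR[OF \<phi>(1)] by simp
    next
      case False
      then show ?thesis
        using sublinear_scaleR[OF \<phi>(1), of "- s" x] odd[of "s *\<^sub>R x"] by simp
    qed
    show "norm (\<phi> x) \<le> norm x * 1" for x using abs[of x] by simp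
  qed
  moreover have "\<phi> c = norm c"
  proof -
    have "\<phi> (- c) \<le> - norm c" using \<phi>(2) p(3) by (meson le_fun_def order_trans)
    then show ?thesis using odd[of c] le[of c] by simp
  qed
  ultimately show ?thesis using that abs by blast
qed

section \<open>Complex scalars and complex-linear functionals\<close>

interpretation scaleC: vector_space "scaleC :: complex \<Rightarrow> 'a \<Rightarrow> 'a::complex_banach"
  by (rule vector_space_scaleC)

lemma scaleC_scaleR: "c *\<^sub>C (r *\<^sub>R x) = r *\<^sub>R (c *\<^sub>C x)"
  by (simp flip: scaleC_of_real add: mult.commute)

lemma bounded_linear_scaleC_right: "bounded_linear (scaleC c)"
  by (rule bounded_linear_intro[where K = "cmod c"])
    (simp_all add: scaleC_add_right scaleC_scaleR norm_scaleC)

lemma separating_functional: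
  fixes c :: "'a::complex_banach"
  assumes "c \<noteq> 0"
  obtains \<psi> :: "'a \<Rightarrow> complex"
  where "bounded_linear \<psi>" "\<And>z x. \<psi> (z *\<^sub>C x) = z * \<psi> x" "\<psi> c = 1"
proof -
  obtain \<phi> :: "'a \<Rightarrow> real"
    where \<phi>: "bounded_linear \<phi>" "\<phi> c = norm c" by (rule real_norming_functional[of c]) blast
  interpret \<phi>: bounded_linear \<phi> by fact
  \<comment> \<open>The usual complexification: the complex-linear functional with real part
    \<open>\<phi>\<close>.\<close>
  define \<xi> where "\<xi> = (\<lambda>x. complex_of_real (\<phi> x) - \<i> * complex_of_real (\<phi> (\<i> *\<^sub>C x)))"
  have bl: "bounded_linear \<xi>"
    unfolding \<xi>_def
    by (intro bounded_linear_sub bounded_linear_const_mult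
        bounded_linear_compose[OF bounded_linear_of_real]
        bounded_linear_compose[OF \<phi>(1)] bounded_linear_scaleC_right bounded_linear_ident)
  have hom: "\<xi> (z *\<^sub>C x) = z * \<xi> x" for z x
  proof -
    \<comment> \<open>\<open>\<xi>\<close> evaluates \<open>\<phi>\<close> at
      \<open>z *\<^sub>C x\<close> and at \<open>\<i> *\<^sub>C z *\<^sub>C x\<close>. Both are real
      combinations of \<open>x\<close> and \<open>\<i> *\<^sub>C x\<close>, to which real linearity
      of \<open>\<phi>\<close> applies.\<close>
    have z: "z *\<^sub>C x = Re z *\<^sub>R x + Im z *\<^sub>R (\<i> *\<^sub>C x)" for x
      by (subst complex_eq)
        (simp add: scaleC_add_left scaleC_of_real flip: scaleC_scaleC scaleC_scaleR)
    have iz: "\<i> *\<^sub>C z *\<^sub>C x = Re z *\<^sub>R (\<i> *\<^sub>C x) - Im z *\<^sub>R x"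
      by (simp add: z scaleC_add_right scaleC_scaleR)
    show ?thesis
      unfolding \<xi>_def iz unfolding z
      by (simp add: \<phi>.add \<phi>.diff \<phi>.scaleR complex_eq_iff algebra_simps)
  qed
  have "Re (\<xi> c) = norm c" by (simp add: \<xi>_def \<phi>(2))
  with assms have nz: "\<xi> c \<noteq> 0" by auto
  show ?thesis
  proof (rule that)
    show "bounded_linear (\<lambda>x. \<xi> x / \<xi> c)"
      using bounded_linear_compose[OF bounded_linear_divide bl] by (simp add: o_def)
  qed (use nz in \<open>simp_all add: hom\<close>)
qed

subsection \<open>Operators and holomorphic maps\<close>

lemma bounded_operatorsI:
  "bounded_linear T \<Longrightarrow> (\<And>c x. T (c *\<^sub>C x) = c *\<^sub>C T x) \<Longrightarrow> T \<in> bounded_operators"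
  by (simp add: bounded_operators_def)

lemma bounded_operatorsD:
  assumes "T \<in> bounded_operators"
  shows "bounded_linear T" "T (c *\<^sub>C x) = c *\<^sub>C T x"
  using assms by (simp_all add: bounded_operators_def)

lemma id_in_bounded_operators: "id \<in> bounded_operators"
  by (simp add: bounded_operators_def id_def)

lemma zero_in_bounded_operators: "(\<lambda>x. 0) \<in> bounded_operators"
  by (simp add: bounded_operators_def)

lemma add_in_bounded_operators:
  "S \<in> bounded_operators \<Longrightarrow> T \<in> bounded_operators \<Longrightarrow> (\<lambda>x. S x + T x) \<in> bounded_operators"
  by (simp add: bounded_operators_def bounded_linear_add scaleC_add_right)

lemma diff_in_bounded_operators:
  "S \<in> bounded_operators \<Longrightarrow> T \<in> bounded_operators \<Longrightarrow> (\<lambda>x. S x - T x) \<in> bounded_operators"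
  by (simp add: bounded_operators_def bounded_linear_sub scaleC.scale_right_diff_distrib)

lemma rank_one_in_bounded_operators:
  fixes \<psi> :: "'a::complex_banach \<Rightarrow> complex"
  assumes \<psi>: "bounded_linear \<psi>" "\<And>c x. \<psi> (c *\<^sub>C x) = c * \<psi> x"
  shows "(\<lambda>x. \<psi> x *\<^sub>C y) \<in> bounded_operators"
proof (rule bounded_operatorsI)
  have "(r *\<^sub>R z) *\<^sub>C y = r *\<^sub>R (z *\<^sub>C y)" for r z
    by (metis scaleC_of_real scaleC_scaleC scaleR_conv_of_real)
  then have "bounded_linear (\<lambda>z. z *\<^sub>C y)"
    by (intro bounded_linear_intro[where K = "norm y"])
      (simp_all add: scaleC_add_left norm_scaleC)
  then show "bounded_linear (\<lambda>x. \<psi> x *\<^sub>C y)" by (rule bounded_linear_compose[OF _ \<psi>(1)])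
qed (simp add: \<psi>(2) scaleC_scaleC)

text \<open>By uniqueness of derivatives, the operator chosen by \<open>frechet_derivative\<close>
  is the complex-linear witness from \<open>holomorphic\<close>.\<close>

lemma holomorphic_has_derivative:
  assumes "holomorphic f"
  shows "(f has_derivative frechet_derivative f (at x)) (at x)"
    and "frechet_derivative f (at x) \<in> bounded_operators"
proof -
  obtain D where D: "D \<in> bounded_operators" "(f has_derivative D) (at x)"
    using assms unfolding holomorphic_def by blast
  with frechet_derivative_at[OF D(2)]
  show "(f has_derivative frechet_derivative f (at x)) (at x)"
    "frechet_derivative f (at x) \<in> bounded_operators" by simp_all
qed

lemma bounded_operators_subset_holomorphic_bounded: "bounded_operators \<subseteq> holomorphic_bounded"
proof
  fix T :: "'a \<Rightarrow> 'a" assume T: "T \<in> bounded_operators"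
  have "holomorphic T"
    unfolding holomorphic_def
    using T bounded_linear_imp_has_derivative[OF bounded_operatorsD(1)[OF T]] by blast
  then show "T \<in> holomorphic_bounded"
    by (simp add: holomorphic_bounded_def bounded_linear_image bounded_operatorsD(1)[OF T])
qed

lemma id_in_holomorphic_bounded: "id \<in> holomorphic_bounded"
  using id_in_bounded_operators bounded_operators_subset_holomorphic_bounded by blast

lemma const_in_holomorphic_bounded: "(\<lambda>x. y) \<in> holomorphic_bounded"
proof -
  have "holomorphic (\<lambda>x. y)"
    unfolding holomorphic_def using zero_in_bounded_operators by (blast intro: has_derivative_const)
  moreover have "bounded ((\<lambda>x. y) ` B)" for B :: "'a set"
    by (rule bounded_subset[of "{y}"]) auto
  ultimately show ?thesis by (simp add: holomorphic_bounded_def)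
qed

lemma translation_in_holomorphic_bounded: "(\<lambda>x. a + x) \<in> holomorphic_bounded"
proof -
  have "((+) a has_derivative id) (at x)" for x :: 'a
    by (auto intro!: derivative_eq_intros)
  then have "holomorphic ((+) a)"
    unfolding holomorphic_def using id_in_bounded_operators by blast
  then show ?thesis by (simp add: holomorphic_bounded_def bounded_translation)
qed

text \<open>Otherwise the open complement of \<open>I\<close> would contain a basic neighbourhood of
  \<open>f\<close>, which the approximants from \<open>I\<close> must meet.\<close>

lemma closedin_Hb_topologyD:
  assumes "closedin Hb_topology I" "f \<in> holomorphic_bounded"
    and approx: "\<And>B e. bounded B \<Longrightarrow> 0 < e \<Longrightarrow> \<exists>g\<in>I. \<forall>x\<in>B. norm (g x - f x) < e"
  shows "f \<in> I"
proof (rule ccontr)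
  assume "f \<notin> I"
  have I: "I \<subseteq> holomorphic_bounded"
    and "openin Hb_topology (holomorphic_bounded - I)"
    using assms(1) by (simp_all add: closedin_def topspace_Hb_topology)
  with \<open>f \<notin> I\<close> assms(2) obtain B e where "bounded B" "0 < e"
    and sub: "{g \<in> holomorphic_bounded. \<forall>x\<in>B. norm (g x - f x) < e} \<subseteq> holomorphic_bounded - I"
    unfolding openin_Hb_topology by blast
  then obtain g where "g \<in> I" "\<forall>x\<in>B. norm (g x - f x) < e" using approx by blast
  with sub I show False by blast
qed

subsection \<open>Ideals of holomorphic maps\<close>

locale holomorphic_ideal_on =
  fixes I :: "('a::complex_banach \<Rightarrow> 'a) set"
  assumes ideal: "holomorphic_ideal I"
begin

lemma holomorphicD: "f \<in> I \<Longrightarrow> holomorphic f"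
  using ideal by (auto simp: holomorphic_ideal_def holomorphic_bounded_def)

lemma zero_in: "(\<lambda>x. 0) \<in> I"
  using ideal by (simp add: holomorphic_ideal_def linear_subspace_of_maps_def)

lemma add_in: "f \<in> I \<Longrightarrow> g \<in> I \<Longrightarrow> (\<lambda>x. f x + g x) \<in> I"
  using ideal by (simp add: holomorphic_ideal_def linear_subspace_of_maps_def)

lemma scaleC_in: "f \<in> I \<Longrightarrow> (\<lambda>x. c *\<^sub>C f x) \<in> I"
  using ideal by (simp add: holomorphic_ideal_def linear_subspace_of_maps_def)

lemma diff_in: "f \<in> I \<Longrightarrow> g \<in> I \<Longrightarrow> (\<lambda>x. f x - g x) \<in> I"
  using add_in[OF _ scaleC_in, of f g "- 1"] by simp

lemma comp_in: "f \<in> holomorphic_bounded \<Longrightarrow> g \<in> I \<Longrightarrow> h \<in> holomorphic_bounded \<Longrightarrow> f \<circ> g \<circ> h \<in> I"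
  using ideal by (simp add: holomorphic_ideal_def)

lemma comp_left_in: "f \<in> holomorphic_bounded \<Longrightarrow> g \<in> I \<Longrightarrow> f \<circ> g \<in> I"
  using comp_in[OF _ _ id_in_holomorphic_bounded, of f g] by simp

lemma comp_right_in: "g \<in> I \<Longrightarrow> h \<in> holomorphic_bounded \<Longrightarrow> g \<circ> h \<in> I"
  using comp_in[OF id_in_holomorphic_bounded, of g h] by simp

text \<open>The set I_L of the theorem, kept as an abbreviation so that facts about it match the
  final statement literally.\<close>

abbreviation derivatives_at_zero :: "('a \<Rightarrow> 'a) set"
  where "derivatives_at_zero \<equiv> {frechet_derivative f (at 0) | f. f \<in> I}"

lemma derivatives_at_zeroI: "f \<in> I \<Longrightarrow> (f has_derivative D) (at 0) \<Longrightarrow> D \<in> derivatives_at_zero"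
  using frechet_derivative_at by blast

lemma derivatives_at_zeroE:
  assumes "D \<in> derivatives_at_zero"
  obtains f where "f \<in> I" "(f has_derivative D) (at 0)" "D \<in> bounded_operators"
  using assms holomorphic_has_derivative[OF holomorphicD] by blast

text \<open>A translation has the identity as derivative, so it carries the derivative at
  \<open>x\<close> unchanged to the origin.\<close>

lemma translate_in:
  assumes "f \<in> I"
  shows "(\<lambda>y. f (x + y)) \<in> I"
    and "((\<lambda>y. f (x + y)) has_derivative frechet_derivative f (at x)) (at 0)"
proof -
  show "(\<lambda>y. f (x + y)) \<in> I"
    using comp_right_in[OF assms translation_in_holomorphic_bounded[of x]] by (simp add: o_def)
  have "((\<lambda>y. x + y) has_derivative (\<lambda>y. y)) (at 0)"
    by (auto intro!: derivative_eq_intros)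
  from has_derivative_compose[OF this, of f "frechet_derivative f (at x)"]
  show "((\<lambda>y. f (x + y)) has_derivative frechet_derivative f (at x)) (at 0)"
    using holomorphic_has_derivative(1)[OF holomorphicD[OF assms]] by simp
qed

lemma derivatives_at_zero_eq: "derivatives_at_zero = {frechet_derivative f (at x) | f x. f \<in> I}"
proof
  show "{frechet_derivative f (at x) | f x. f \<in> I} \<subseteq> derivatives_at_zero"
  proof (rule subsetI, elim CollectE exE conjE)
    fix D f x assume "D = frechet_derivative f (at x)" "f \<in> I"
    then show "D \<in> derivatives_at_zero"
      using derivatives_at_zeroI[OF translate_in[of f x]] by simp
  qed
qed blast

lemma operator_ideal_derivatives: "operator_ideal derivatives_at_zero"
  unfolding operator_ideal_def linear_subspace_of_maps_def
proof (intro conjI ballI allI)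
  show "derivatives_at_zero \<subseteq> bounded_operators"
    by (rule subsetI) (erule derivatives_at_zeroE)
  show "(\<lambda>x. 0) \<in> derivatives_at_zero"
    by (rule derivatives_at_zeroI[OF zero_in]) simp
  fix D assume "D \<in> derivatives_at_zero"
  then obtain f where f: "f \<in> I" "(f has_derivative D) (at 0)" and D: "D \<in> bounded_operators"
    by (rule derivatives_at_zeroE)
  show "(\<lambda>x. c *\<^sub>C D x) \<in> derivatives_at_zero" for c
    by (rule derivatives_at_zeroI[OF scaleC_in[OF f(1)]
        bounded_linear.has_derivative[OF bounded_linear_scaleC_right f(2)]])
  show "(\<lambda>x. D x + E x) \<in> derivatives_at_zero" if E: "E \<in> derivatives_at_zero" for E
  proof -
    obtain g where g: "g \<in> I" "(g has_derivative E) (at 0)"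
      using E by (rule derivatives_at_zeroE)
    show ?thesis
      by (rule derivatives_at_zeroI[OF add_in[OF f(1) g(1)] has_derivative_add[OF f(2) g(2)]])
  qed
  fix S :: "'a \<Rightarrow> 'a" assume S: "S \<in> bounded_operators"
  then have Sh: "S \<in> holomorphic_bounded" and Sl: "bounded_linear S"
    using bounded_operators_subset_holomorphic_bounded by (blast intro: bounded_operatorsD)+
  show "S \<circ> D \<in> derivatives_at_zero"
    using derivatives_at_zeroI[OF comp_left_in[OF Sh f(1)]]
      bounded_linear.has_derivative[OF Sl f(2)] by (simp add: o_def)
  \<comment> \<open>The inner map fixes the origin, so the chain rule uses the derivative of
    \<open>f\<close> at the same point.\<close>
  have "S 0 = 0" using Sl by (simp add: linear_simps)
  with f(2) have "((\<lambda>x. f (S x)) has_derivative (\<lambda>x. D (S x))) (at 0)"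
    by (intro has_derivative_compose[OF bounded_linear_imp_has_derivative[OF Sl]]) simp
  then show "D \<circ> S \<in> derivatives_at_zero"
    using derivatives_at_zeroI[OF comp_right_in[OF f(1) Sh]] by (simp add: o_def)
qed

text \<open>A map whose derivative vanishes everywhere is constant; a nonzero derivative at any
  other point is moved to the origin by translation.\<close>

lemma nonzero_derivative:
  assumes "f \<in> I" "\<not> f constant_on UNIV"
  obtains D u where "D \<in> derivatives_at_zero" "D u \<noteq> 0"
proof -
  have "\<exists>x u. frechet_derivative f (at x) u \<noteq> 0"
  proof (rule ccontr)
    assume "\<not> ?thesis"
    then have "frechet_derivative f (at x) = (\<lambda>u. 0)" for x by auto
    then have "(f has_derivative (\<lambda>u. 0)) (at x)" for x
      using holomorphic_has_derivative(1)[OF holomorphicD[OF assms(1)], of x] by simp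
    then obtain c where "\<And>x. f x = c"
      using has_derivative_zero_constant[of UNIV f] by auto
    then show False using assms(2) by (auto simp: constant_on_def)
  qed
  then show ?thesis using that derivatives_at_zero_eq assms(1) by blast
qed

end

section \<open>Closed ideals: finite rank operators and compact mappings\<close>

locale closed_holomorphic_ideal = holomorphic_ideal_on +
  assumes closed: "closedin Hb_topology I"
begin

text \<open>The difference quotients of \<open>f\<close> at the origin belong to the ideal and
  converge to the derivative uniformly on bounded sets, so closedness applies.\<close>

lemma derivatives_at_zero_subset: "derivatives_at_zero \<subseteq> I"
proof
  fix D assume "D \<in> derivatives_at_zero"
  then obtain f where f: "f \<in> I" "(f has_derivative D) (at 0)" and D: "D \<in> bounded_operators"
    by (rule derivatives_at_zeroE)
  have Dl: "bounded_linear D" by (rule bounded_operatorsD[OF D])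
  \<comment> \<open>The constant map with value \<open>f 0\<close> lies in the ideal, so subtracting
    it stays there.\<close>
  have "f \<circ> (\<lambda>x. 0) \<in> I" by (rule comp_right_in[OF f(1) const_in_holomorphic_bounded])
  then have g: "(\<lambda>x. f x - f 0) \<in> I" using diff_in[OF f(1)] by (simp add: o_def)
  have scaled: "(\<lambda>x. inverse r *\<^sub>R (f (r *\<^sub>R x) - f 0)) \<in> I" for r
  proof -
    have "(\<lambda>x::'a. r *\<^sub>R x) \<in> bounded_operators"
      by (intro bounded_operatorsI bounded_linear_scaleR_right) (simp add: scaleC_scaleR)
    then have "(\<lambda>x. f x - f 0) \<circ> (\<lambda>x. r *\<^sub>R x) \<in> I"
      using comp_right_in[OF g] bounded_operators_subset_holomorphic_bounded by blast
    from scaleC_in[OF this, of "complex_of_real (inverse r)"] show ?thesis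
      by (simp only: o_def scaleC_of_real)
  qed
  show "D \<in> I"
  proof (rule closedin_Hb_topologyD[OF closed])
    show "D \<in> holomorphic_bounded"
      using D bounded_operators_subset_holomorphic_bounded by blast
    fix B :: "'a set" and e :: real assume B: "bounded B" and e: "0 < e"
    obtain M where M: "0 < M" "\<And>x. x \<in> B \<Longrightarrow> norm x \<le> M"
      using B unfolding bounded_pos by blast
    \<comment> \<open>The remainder at \<open>r *\<^sub>R x\<close> is at most
      \<open>r * (\<epsilon> * M)\<close>; dividing by \<open>r\<close> leaves
      \<open>\<epsilon> * M\<close>, which is half of \<open>e\<close>.\<close>
    define \<epsilon> where "\<epsilon> = e / (2 * M)"
    have \<epsilon>: "0 < \<epsilon>" "\<epsilon> * M < e" using e M(1) by (simp_all add: \<epsilon>_def)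
    obtain d where d: "0 < d" "\<And>y. norm y < d \<Longrightarrow> norm (f y - f 0 - D y) \<le> \<epsilon> * norm y"
      using f(2) \<epsilon>(1) unfolding has_derivative_at_alt by (metis diff_zero)
    \<comment> \<open>Scaling by \<open>r\<close> brings all of \<open>B\<close> inside the ball of
      radius \<open>d\<close> on which the derivative estimate holds.\<close>
    define r where "r = d / (2 * M)"
    have r: "0 < r" "r * M < d" using d(1) M(1) by (simp_all add: r_def)
    have "norm (inverse r *\<^sub>R (f (r *\<^sub>R x) - f 0) - D x) < e" if x: "x \<in> B" for x
    proof -
      have "norm (r *\<^sub>R x) \<le> r * M" using r(1) M(2)[OF x] by simp
      with r(2) have "norm (f (r *\<^sub>R x) - f 0 - D (r *\<^sub>R x)) \<le> \<epsilon> * norm (r *\<^sub>R x)"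
        by (intro d(2)) simp
      also have "\<dots> \<le> r * (\<epsilon> * M)"
        using r(1) \<epsilon>(1) M(2)[OF x] by simp
      finally have "norm (f (r *\<^sub>R x) - f 0 - D (r *\<^sub>R x)) \<le> r * (\<epsilon> * M)" .
      moreover have "inverse r *\<^sub>R (f (r *\<^sub>R x) - f 0) - D x
          = inverse r *\<^sub>R (f (r *\<^sub>R x) - f 0 - D (r *\<^sub>R x))"
        using r(1) Dl by (simp add: linear_simps scaleR_diff_right)
      ultimately have "norm (inverse r *\<^sub>R (f (r *\<^sub>R x) - f 0) - D x) \<le> inverse r * (r * (\<epsilon> * M))"
        using r(1) by (metis abs_inverse abs_of_pos inverse_positive_iff_positive less_imp_le
            mult_left_mono norm_scaleR)
      also have "\<dots> = \<epsilon> * M" using r(1) by (simp add: field_simps)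
      finally show ?thesis using \<epsilon>(2) by linarith
    qed
    then show "\<exists>g\<in>I. \<forall>x\<in>B. norm (g x - D x) < e"
      by (intro bexI[OF _ scaled[of r]]) simp
  qed
qed

text \<open>The operator factors through \<open>T\<close>: send \<open>x\<close> to a multiple of
  \<open>u\<close>, apply \<open>T\<close>, then use a functional with value 1 at \<open>T u\<close>
  to send \<open>T u\<close> to \<open>y\<close>.\<close>

lemma rank_one_in:
  fixes \<psi> :: "'a \<Rightarrow> complex"
  assumes T: "T \<in> I" "T \<in> bounded_operators" "T u \<noteq> 0"
    and \<psi>: "bounded_linear \<psi>" "\<And>c x. \<psi> (c *\<^sub>C x) = c * \<psi> x"
  shows "(\<lambda>x. \<psi> x *\<^sub>C y) \<in> I"
proof -
  obtain \<xi> :: "'a \<Rightarrow> complex" where \<xi>: "bounded_linear \<xi>" "\<And>c x. \<xi> (c *\<^sub>C x) = c * \<xi> x" "\<xi> (T u) = 1"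
    by (rule separating_functional[OF T(3)]) blast
  have "(\<lambda>x. \<xi> x *\<^sub>C y) \<circ> T \<circ> (\<lambda>x. \<psi> x *\<^sub>C u) \<in> I"
    using bounded_operators_subset_holomorphic_bounded
      rank_one_in_bounded_operators[OF \<xi>(1,2)] rank_one_in_bounded_operators[OF \<psi>]
    by (intro comp_in T(1)) blast+
  then show ?thesis by (simp add: o_def bounded_operatorsD(2)[OF T(2)] \<xi>)
qed

lemma fixing_operator_in:
  assumes T: "T \<in> I" "T \<in> bounded_operators" "T u \<noteq> 0" and "finite B"
  obtains P where "P \<in> I" "P \<in> bounded_operators" "\<And>b. b \<in> B \<Longrightarrow> P b = b"
proof -
  have "\<exists>P. P \<in> I \<and> P \<in> bounded_operators \<and> (\<forall>b\<in>B. P b = b)"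
    using \<open>finite B\<close>
  proof (induction B)
    case empty
    then show ?case using zero_in zero_in_bounded_operators by blast
  next
    case (insert b B)
    then obtain P where P: "P \<in> I" "P \<in> bounded_operators" "\<forall>b\<in>B. P b = b" by blast
    \<comment> \<open>\<open>c\<close> is the error of \<open>P\<close> at the new vector. The
      functional \<open>\<xi>\<close> built from \<open>id - P\<close> is 1 at \<open>b\<close> and
      0 on the vectors already fixed, so adding \<open>\<xi> x *\<^sub>C c\<close> repairs
      \<open>b\<close> without disturbing \<open>B\<close>.\<close>
    define c where "c = b - P b"
    show ?case
    proof (cases "c = 0")
      case True
      then show ?thesis using P c_def by auto
    next
      case False
      obtain \<psi> :: "'a \<Rightarrow> complex"
        where \<psi>: "bounded_linear \<psi>" "\<And>c x. \<psi> (c *\<^sub>C x) = c * \<psi> x" "\<psi> c = 1"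
        by (rule separating_functional[OF False]) blast
      define Q where "Q = (\<lambda>x. id x - P x)"
      define \<xi> where "\<xi> = (\<lambda>x. \<psi> (Q x))"
      have Q: "Q \<in> bounded_operators"
        unfolding Q_def by (intro diff_in_bounded_operators id_in_bounded_operators P(2))
      have \<xi>: "bounded_linear \<xi>" "\<And>c x. \<xi> (c *\<^sub>C x) = c * \<xi> x"
        unfolding \<xi>_def
        using bounded_linear_compose[OF \<psi>(1) bounded_operatorsD(1)[OF Q]]
        by (simp_all add: bounded_operatorsD(2)[OF Q] \<psi>(2))
      let ?P = "\<lambda>x. P x + \<xi> x *\<^sub>C c"
      have "?P \<in> I" by (intro add_in P(1) rank_one_in[OF T \<xi>])
      moreover have "?P \<in> bounded_operators"
        by (intro add_in_bounded_operators P(2) rank_one_in_bounded_operators \<xi>)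
      moreover have "?P x = x" if "x \<in> insert b B" for x
      proof (cases "x = b")
        case True
        then show ?thesis using \<psi>(3) by (simp add: \<xi>_def Q_def c_def scaleC_one)
      next
        case False
        then have "P x = x" using that P(3) by simp
        then show ?thesis using \<psi>(1) by (simp add: \<xi>_def Q_def linear_simps)
      qed
      ultimately show ?thesis by blast
    qed
  qed
  then show ?thesis using that by blast
qed

text \<open>The fixed points of \<open>P\<close> form a complex subspace, so fixing the finite set
  \<open>B\<close> fixes the whole range of \<open>S\<close>.\<close>

lemma finite_rank_subset:
  assumes T: "T \<in> I" "T \<in> bounded_operators" "T u \<noteq> 0"
  shows "finite_rank_operators \<subseteq> I"
proof
  fix S :: "'a \<Rightarrow> 'a" assume "S \<in> finite_rank_operators"
  then obtain B where S: "S \<in> bounded_operators" and B: "finite B" "range S \<subseteq> scaleC.span B"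
    unfolding finite_rank_operators_def by blast
  obtain P where P: "P \<in> I" "P \<in> bounded_operators" "\<And>b. b \<in> B \<Longrightarrow> P b = b"
    by (rule fixing_operator_in[OF T B(1)]) blast
  have "scaleC.subspace {x. P x = x}"
    using bounded_operatorsD[OF P(2)]
    by (intro scaleC.subspaceI) (simp_all add: linear_simps)
  then have "scaleC.span B \<subseteq> {x. P x = x}" by (intro scaleC.span_minimal) (use P(3) in blast)
  with B(2) have "P \<circ> S = S" by (auto simp: fun_eq_iff)
  then show "S \<in> I"
    using comp_right_in[OF P(1), of S] S bounded_operators_subset_holomorphic_bounded by auto
qed

lemma holomorphic_compact_subset:
  assumes "finite_rank_operators \<subseteq> I" and "approximation_property TYPE('a)"
  shows "holomorphic_compact \<subseteq> I"
proof
  fix f :: "'a \<Rightarrow> 'a" assume "f \<in> holomorphic_compact"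
  then have f: "f \<in> holomorphic_bounded" and comp: "\<And>B. bounded B \<Longrightarrow> compact (closure (f ` B))"
    by (simp_all add: holomorphic_compact_def)
  show "f \<in> I"
  proof (rule closedin_Hb_topologyD[OF closed f])
    fix B :: "'a set" and e :: real assume "bounded B" "0 < e"
    then have "\<exists>T\<in>finite_rank_operators. \<forall>v\<in>closure (f ` B). norm (T v - v) < e"
      using assms(2) comp by (simp add: approximation_property_def)
    then obtain T where T: "T \<in> finite_rank_operators"
      and close: "\<And>v. v \<in> closure (f ` B) \<Longrightarrow> norm (T v - v) < e"
      by blast
    have "T \<circ> f \<in> I" using T assms(1) by (intro comp_right_in f) blast
    moreover have "norm ((T \<circ> f) x - f x) < e" if "x \<in> B" for x
      using close[of "f x"] closure_subset[of "f ` B"] that by auto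
    ultimately show "\<exists>g\<in>I. \<forall>x\<in>B. norm (g x - f x) < e" by blast
  qed
qed

end

theorem proposition3p2:
  fixes I :: "('a::complex_banach \<Rightarrow> 'a) set"
  assumes "holomorphic_ideal I"
  shows "(operator_ideal {frechet_derivative f (at 0) | f. f \<in> I} \<and>
          {frechet_derivative f (at 0) | f. f \<in> I} =
            {frechet_derivative f (at x) | f x. f \<in> I}) \<and>
         (closedin Hb_topology I \<and> (\<exists>f\<in>I. \<not> f constant_on UNIV) \<longrightarrow>
          finite_rank_operators \<subseteq> I \<and>
          (approximation_property TYPE('a) \<longrightarrow> holomorphic_compact \<subseteq> I))"
proof -
  interpret holomorphic_ideal_on I by unfold_locales (rule assms)
  have "closedin Hb_topology I \<and> (\<exists>f\<in>I. \<not> f constant_on UNIV) \<longrightarrow>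
    finite_rank_operators \<subseteq> I \<and> (approximation_property TYPE('a) \<longrightarrow> holomorphic_compact \<subseteq> I)"
  proof (intro impI, elim conjE bexE)
    fix f assume "closedin Hb_topology I" and f: "f \<in> I" "\<not> f constant_on UNIV"
    interpret closed_holomorphic_ideal I by unfold_locales fact
    \<comment> \<open>\<open>T\<close> may come from a translate of \<open>f\<close>, whose own
      derivative at the origin can vanish.\<close>
    obtain T u where T: "T \<in> derivatives_at_zero" "T u \<noteq> 0" using nonzero_derivative[OF f] .
    have "T \<in> I" using T(1) derivatives_at_zero_subset by (rule rev_subsetD)
    moreover have "T \<in> bounded_operators" using T(1) by (rule derivatives_at_zeroE)
    ultimately have "finite_rank_operators \<subseteq> I" using T(2) by (rule finite_rank_subset)
    then show "finite_rank_operators \<subseteq> I \<and>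
        (approximation_property TYPE('a) \<longrightarrow> holomorphic_compact \<subseteq> I)"
      using holomorphic_compact_subset by simp
  qed
  then show ?thesis
    by (intro conjI operator_ideal_derivatives derivatives_at_zero_eq)
qed

end
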